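(* Let $G$ be a finite simple graph on $n \geq 2$ vertices with at least one edge. Then $\operatorname{dmg}(G; s) \leq n-2$ for each integer $s \geq 1$.
   Context: All graphs are finite, undirected and simple, and need not be connected. The game with one cop and $s$ robbers on a graph $G$ is a perfect-information game. In round $0$ the cop chooses an initial vertex, and then each robber chooses an initial vertex (several robbers may share a vertex). Each subsequent round consists of a turn for the cop followed by a turn for the robbers; on their turn, each player may stay put or move to a neighboring vertex (on the robbers' turn every uncaptured robber may do so). Whenever the cop occupies the same vertex as one or more robbers, all those robbers are captured and take no further part in the game. If a robber occupies a vertex $v$ at the end of some round (including round $0$) and that robber is not captured in the following round, then $v$ becomes damaged (and stays damaged). The robbers aim to maximize, and the cop aims to minimize, the total number of damaged vertices. The $s$-robber damage number $\operatorname{dmg}(G;s)$ is the number of vertices damaged under optimal play, i.e. the smallest $d$ such that the cop has a strategy guaranteeing that at most $d$ vertices are ever damaged, whatever the $s$ robbers do. *)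

theory Defs
  imports "Graph_Theory.Pair_Digraph"
begin

text \<open>
  A finite simple undirected graph is a \<^locale>\<open>pair_graph\<close>: a finite, loopfree, symmetric
  relation \<^const>\<open>parcs\<close> on a finite vertex set \<^const>\<open>pverts\<close>; an edge \<open>uv\<close> is represented by the
  two pairs \<open>(u, v)\<close> and \<open>(v, u)\<close>.
\<close>

definition legal_move :: "'a pair_pre_digraph \<Rightarrow> 'a \<Rightarrow> 'a \<Rightarrow> bool" where
  "legal_move G u v \<longleftrightarrow> v = u \<or> (u, v) \<in> parcs G"

text \<open>
  A position at the end of a round consists of the vertex of the cop and of the vertices of the
  robbers \<open>0, \<dots>, s - 1\<close>, where \<^const>\<open>None\<close> marks a captured robber. Indices \<open>i \<ge> s\<close>
  do not belong to a robber and are \<^const>\<open>None\<close> throughout.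
\<close>

type_synonym 'a robbers = "nat \<Rightarrow> 'a option"
type_synonym 'a position = "'a \<times> 'a robbers"

definition capture :: "'a \<Rightarrow> 'a robbers \<Rightarrow> 'a robbers" where
  "capture c R = (\<lambda>i. if R i = Some c then None else R i)"

text \<open>Round 0: a robber that starts on the vertex of the cop is captured at once.\<close>

definition initial_position :: "'a pair_pre_digraph \<Rightarrow> nat \<Rightarrow> 'a position \<Rightarrow> bool" where
  "initial_position G s p \<longleftrightarrow>
     fst p \<in> pverts G \<and>
     (\<exists>R. (\<forall>i<s. \<exists>v\<in>pverts G. R i = Some v) \<and> (\<forall>i\<ge>s. R i = None) \<and>
          snd p = capture (fst p) R)"

definition robbers_turn :: "'a pair_pre_digraph \<Rightarrow> 'a robbers \<Rightarrow> 'a robbers \<Rightarrow> bool" where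
  "robbers_turn G R R' \<longleftrightarrow>
     (\<forall>i. case R i of None \<Rightarrow> R' i = None
                    | Some v \<Rightarrow> (\<exists>w. legal_move G v w \<and> R' i = Some w))"

text \<open>
  One later round: captures happen after the turn of the cop (before the robbers move) and again
  after the turn of the robbers.
\<close>

definition game_round :: "'a pair_pre_digraph \<Rightarrow> 'a position \<Rightarrow> 'a position \<Rightarrow> bool" where
  "game_round G p q \<longleftrightarrow>
     legal_move G (fst p) (fst q) \<and>
     (\<exists>R. robbers_turn G (capture (fst q) (snd p)) R \<and> snd q = capture (fst q) R)"

text \<open>
  A cop strategy maps the list of all earlier positions, oldest first, to the next vertex of the
  cop; its value on the empty list is the initial vertex.
\<close>

type_synonym 'a strategy = "'a position list \<Rightarrow> 'a"

definition cop_strategy :: "'a pair_pre_digraph \<Rightarrow> 'a strategy \<Rightarrow> bool" where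
  "cop_strategy G \<sigma> \<longleftrightarrow>
     \<sigma> [] \<in> pverts G \<and> (\<forall>h. h \<noteq> [] \<longrightarrow> legal_move G (fst (last h)) (\<sigma> h))"

definition play :: "'a pair_pre_digraph \<Rightarrow> nat \<Rightarrow> 'a strategy \<Rightarrow> (nat \<Rightarrow> 'a position) \<Rightarrow> bool" where
  "play G s \<sigma> p \<longleftrightarrow>
     initial_position G s (p 0) \<and>
     (\<forall>t. game_round G (p t) (p (Suc t))) \<and>
     (\<forall>t. fst (p t) = \<sigma> (map p [0..<t]))"

definition damaged :: "(nat \<Rightarrow> 'a position) \<Rightarrow> 'a set" where
  "damaged p = {v. \<exists>t i. snd (p t) i = Some v \<and> snd (p (Suc t)) i \<noteq> None}"

definition cop_guarantees :: "'a pair_pre_digraph \<Rightarrow> nat \<Rightarrow> nat \<Rightarrow> bool" where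
  "cop_guarantees G s d \<longleftrightarrow>
     (\<exists>\<sigma>. cop_strategy G \<sigma> \<and> (\<forall>p. play G s \<sigma> p \<longrightarrow> card (damaged p) \<le> d))"

text \<open>
  On a nonempty finite graph the minimum exists and the cardinalities are those of finite sets;
  see \<open>cop_guarantees_dmg\<close> and \<open>damaged_subset\<close> below.
\<close>

definition dmg :: "'a pair_pre_digraph \<Rightarrow> nat \<Rightarrow> nat" where
  "dmg G s = (LEAST d. cop_guarantees G s d)"

lemma damaged_subset:
  assumes "pair_graph G" and "play G s \<sigma> p"
  shows "damaged p \<subseteq> pverts G"
proof -
  interpret pair_graph G by fact
  have "\<forall>i v. snd (p t) i = Some v \<longrightarrow> v \<in> pverts G" for t
  proof (induction t)
    case 0
    from assms(2) obtain R where
      R: "\<forall>i<s. \<exists>v\<in>pverts G. R i = Some v" "\<forall>i\<ge>s. R i = None" "snd (p 0) = capture (fst (p 0)) R"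
      unfolding play_def initial_position_def by blast
    show ?case
    proof (intro allI impI)
      fix i v assume "snd (p 0) i = Some v"
      with R(3) have "R i = Some v" by (auto simp: capture_def split: if_splits)
      show "v \<in> pverts G"
      proof (cases "i < s")
        case True
        with R(1) obtain w where "w \<in> pverts G" "R i = Some w" by blast
        with \<open>R i = Some v\<close> show ?thesis by simp
      next
        case False
        with R(2) \<open>R i = Some v\<close> show ?thesis by simp
      qed
    qed
  next
    case (Suc t)
    from assms(2) have "game_round G (p t) (p (Suc t))" by (simp add: play_def)
    then obtain R where
      R: "robbers_turn G (capture (fst (p (Suc t))) (snd (p t))) R"
         "snd (p (Suc t)) = capture (fst (p (Suc t))) R"
      unfolding game_round_def by blast
    show ?case
    proof (intro allI impI)
      fix i w assume "snd (p (Suc t)) i = Some w"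
      with R(2) have w: "R i = Some w" by (auto simp: capture_def split: if_splits)
      with R(1) obtain v where
        v: "capture (fst (p (Suc t))) (snd (p t)) i = Some v" "legal_move G v w"
        unfolding robbers_turn_def
        by (cases "capture (fst (p (Suc t))) (snd (p t)) i") (auto dest!: spec[of _ i])
      then have "snd (p t) i = Some v" by (auto simp: capture_def split: if_splits)
      with Suc.IH have "v \<in> pverts G" by blast
      with v(2) show "w \<in> pverts G" by (auto simp: legal_move_def dest: in_arcsD2)
    qed
  qed
  then show ?thesis by (auto simp: damaged_def)
qed

lemma cop_guarantees_dmg:
  assumes "pair_graph G" and "pverts G \<noteq> {}"
  shows "cop_guarantees G s (dmg G s)"
proof -
  interpret pair_graph G by fact
  from assms(2) obtain u where "u \<in> pverts G" by blast
  then have "cop_strategy G (\<lambda>h. if h = [] then u else fst (last h))"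
    by (simp add: cop_strategy_def legal_move_def)
  moreover have "card (damaged p) \<le> card (pverts G)" if "play G s \<sigma> p" for \<sigma> p
    using damaged_subset[OF assms(1) that] by (simp add: card_mono pair_finite_verts)
  ultimately have "cop_guarantees G s (card (pverts G))"
    unfolding cop_guarantees_def by blast
  then show ?thesis unfolding dmg_def by (rule LeastI)
qed

end

theory Submission
  imports Defs
begin

text \<open>
  The cop oscillates along a fixed edge \<open>uv\<close>. At the end of a round the vertex of the cop carries
  no uncaptured robber, and a robber on the other end of the edge is captured by the next move of
  the cop. Hence neither \<open>u\<close> nor \<open>v\<close> is ever damaged.
\<close>

text \<open>Round 0 and every later round end with a \<open>capture\<close> at the current vertex of
  the cop.\<close>

lemma play_robber_not_on_cop:
  assumes "play G s \<sigma> p"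
  shows "snd (p t) i \<noteq> Some (fst (p t))"
proof (cases t)
  case 0
  with assms show ?thesis
    by (auto simp: play_def initial_position_def capture_def split: if_splits)
next
  case (Suc k)
  from assms have "game_round G (p k) (p (Suc k))" by (simp add: play_def)
  with Suc show ?thesis by (auto simp: game_round_def capture_def split: if_splits)
qed

text \<open>The cop moves first in a round, so the robber is removed before it can flee, and
  \<open>robbers_turn\<close> keeps \<open>None\<close> as \<open>None\<close>.\<close>

lemma play_captured_by_cop_move:
  assumes "play G s \<sigma> p" and "snd (p t) i = Some (fst (p (Suc t)))"
  shows "snd (p (Suc t)) i = None"
proof -
  from assms(1) have "game_round G (p t) (p (Suc t))" by (simp add: play_def)
  then obtain R where
    R: "robbers_turn G (capture (fst (p (Suc t))) (snd (p t))) R"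
       "snd (p (Suc t)) = capture (fst (p (Suc t))) R"
    by (auto simp: game_round_def)
  from assms(2) have "capture (fst (p (Suc t))) (snd (p t)) i = None"
    by (simp add: capture_def)
  with R(1) have "R i = None"
    unfolding robbers_turn_def by (auto dest!: spec[of _ i])
  with R(2) show ?thesis by (simp add: capture_def)
qed

text \<open>The last branch is never reached in a play: \<open>cop_strategy\<close> asks for a legal
  move after every nonempty history, even one with the cop off the edge, and staying put is
  legal.\<close>

definition oscillate :: "'a \<Rightarrow> 'a \<Rightarrow> 'a strategy" where
  "oscillate u v h =
     (if h = [] then u else if fst (last h) = u then v
      else if fst (last h) = v then u else fst (last h))"

lemma cop_strategy_oscillate:
  assumes "pair_graph G" and "(u, v) \<in> parcs G"
  shows "cop_strategy G (oscillate u v)"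
proof -
  interpret pair_graph G by fact
  from assms(2) have "(v, u) \<in> parcs G" by (rule arcs_symmetric)
  with assms(2) show ?thesis
    by (auto simp: cop_strategy_def oscillate_def legal_move_def dest: in_arcsD1)
qed

text \<open>Speaking of two consecutive positions as a set avoids the parity of \<open>t\<close> and
  lets the induction go through.\<close>

lemma play_oscillate:
  assumes "play G s (oscillate u v) p"
  shows "{fst (p t), fst (p (Suc t))} = {u, v}"
proof (induction t)
  case 0
  from assms have "\<forall>t. fst (p t) = oscillate u v (map p [0..<t])" by (simp add: play_def)
  from this[rule_format, of 0] this[rule_format, of "Suc 0"] show ?case
    by (simp add: oscillate_def)
next
  case (Suc t)
  \<comment> \<open>The last entry of this history is \<open>p (Suc t)\<close>, so the cop moves on
    to the other end of the edge.\<close>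
  from assms have "fst (p (Suc (Suc t))) = oscillate u v (map p [0..<Suc (Suc t)])"
    unfolding play_def by blast
  with Suc show ?case by (auto simp: oscillate_def)
qed

lemma oscillate_protects:
  assumes "play G s (oscillate u v) p"
  shows "damaged p \<inter> {u, v} = {}"
proof -
  have False if "w \<in> damaged p" "w \<in> {u, v}" for w
  proof -
    from that(1) obtain t i where
      w: "snd (p t) i = Some w" "snd (p (Suc t)) i \<noteq> None"
      by (auto simp: damaged_def)
    \<comment> \<open>In the first case no robber can stand on \<open>w\<close> at time
      \<open>t\<close>; in the second the robber there does not survive the round.\<close>
    from that(2) have "w = fst (p t) \<or> w = fst (p (Suc t))"
      using play_oscillate[OF assms, of t] by blast
    with w show False
      using play_robber_not_on_cop[OF assms, of t i]
        play_captured_by_cop_move[OF assms, of t i] by auto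
  qed
  then show ?thesis by blast
qed

theorem proposition2p2:
  fixes G :: "'a pair_pre_digraph" and n s :: nat
  assumes "pair_graph G"
    and "card (pverts G) = n" and "n \<ge> 2"
    and "parcs G \<noteq> {}"
    and "s \<ge> 1"
  shows "dmg G s \<le> n - 2"
proof -
  interpret pair_graph G by fact
  from assms(4) obtain u v where uv: "(u, v) \<in> parcs G" by auto
  then have ends: "{u, v} \<subseteq> pverts G" by (auto dest: in_arcsD1 in_arcsD2)
  \<comment> \<open>Without loops the edge has two distinct ends, which gives the 2 in the
    bound.\<close>
  from uv have "u \<noteq> v" using no_loops by fastforce
  with ends assms(2) have card: "card (pverts G - {u, v}) = n - 2"
    by (simp add: card_Diff_subset)
  have "card (damaged p) \<le> n - 2" if "play G s (oscillate u v) p" for p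
  proof -
    have "damaged p \<subseteq> pverts G - {u, v}"
      using damaged_subset[OF assms(1) that] oscillate_protects[OF that] by blast
    then have "card (damaged p) \<le> card (pverts G - {u, v})"
      by (simp add: card_mono pair_finite_verts)
    with card show ?thesis by simp
  qed
  with cop_strategy_oscillate[OF assms(1) uv] have "cop_guarantees G s (n - 2)"
    unfolding cop_guarantees_def by blast
  then show ?thesis unfolding dmg_def by (rule Least_le)
qed

end
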